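(* Let $\mathcal X$ be a finite set with $n$ elements, $x\in\mathcal X$, and $A,B\subseteq\mathcal X$ with $A\neq\emptyset$, $B\neq\emptyset$, $A\cap B=\emptyset$ and $x\notin A\cup B$. Let $$N(x,A,B)=\{f\in\mathbb R^n\colon f(y)\le f(x)\ \forall y\in A,\ f(z)\ge f(x)\ \forall z\in B,\ f(w)=f(x)\ \forall w\in\mathcal X\setminus(A\cup B)\}.$$ Then: (i) $N(x,A,B)$ is a cone. (ii) A coherent PRI model $(l,u)$ exists such that $N(x,A,B)$ is a normal cone of its credal set. (iii) $A\cup B=\{x\}^c$ if and only if $N(x,A,B)$ is a maximal elementary simplicial cone (MESC). (iv) If $A'\subseteq A$ and $B'\subseteq B$ (both nonempty), then $N(x,A',B')$ is a face of $N(x,A,B)$. (v) $\mathrm{ri}(N(x,A,B))=\{f\in\mathbb R^n\colon f(y)<f(x)\ \forall y\in A,\ f(z)>f(x)\ \forall z\in B,\ f(w)=f(x)\ \forall w\in(A\cup B)^c\}$. (vi) For every vector $f\in\mathbb R^n$ and every $x\in\mathcal X$, $f\in\mathrm{ri}(N(x,[x]^f_-,[x]^f_+))$, where $[x]^f_+=\{y\colon f(y)>f(x)\}$ and $[x]^f_-=\{y\colon f(y)<f(x)\}$, provided that neither $[x]^f_+$ nor $[x]^f_-$ is empty. Moreover, $f\in\mathrm{ri}(N(x,A,B))$ if and only if $A=[x]^f_-$ and $B=[x]^f_+$. (vii) Every vector $f\in\mathbb R^n$ belongs to at most $n-2$ cones of the form $N(x,A,B)$ (with $x,A,B$ varying subject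 to the conditions above). (viii) Let $N(x,A,B)$ and a cone of the form $\mathrm{cone}(\mathcal A)$, where $\mathcal A$ is a maximal chain, be given. Then either $\mathrm{ri}(\mathrm{cone}(\mathcal A))\subseteq N(x,A,B)$ or $\mathrm{ri}(\mathrm{cone}(\mathcal A))\cap N(x,A,B)=\emptyset$.
   Context: Real functions on $\mathcal X$ are identified with vectors in $\mathbb R^n$; $\mathbb I_C$ is the indicator vector of $C\subseteq\mathcal X$. Complements are in $\mathcal X$, and $\mathrm{ri}$ denotes relative interior. A probability interval (PRI) model is a pair $l,u\colon\mathcal X\to\mathbb R$ with $l\le u$; its credal set is $\mathcal M(l,u)=\{P\text{ probability on }\mathcal X\colon l(x)\le P(\{x\})\le u(x)\ \forall x\}$. It is coherent if $\mathcal M(l,u)\neq\emptyset$ and $l(x)=\min_{P\in\mathcal M(l,u)}P(\{x\})$, $u(x)=\max_{P\in\mathcal M(l,u)}P(\{x\})$ for all $x$. A normal cone of $\mathcal M(l,u)$ is a set $\{f\in\mathbb R^n\colon P(f)\le Q(f)\ \forall Q\in\mathcal M(l,u)\}$ for some $P\in\mathcal M(l,u)$, where $P(f)=\sum_x P(\{x\})f(x)$. For a collection $\mathcal A\subseteq2^{\mathcal X}$, $\mathrm{cone}(\mathcal A)=\left\{\sum_{C\in\mathcal A\setminus\{\mathcal X\}}\alpha_C\mathbb I_C+\beta\mathbb I_{\mathcal X}\colon\alpha_C\ge0,\ \beta\in\mathbb R\right\}$. In the PRI setting, a maximal elementary simplicial cone (MESC) is a cone $\mathrm{cone}(\mathcal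 A)$ where $\mathcal A$ consists of $\mathcal X$ together with some sets of the form $\{y\}$ or $\{y\}^c$ ($y\in\mathcal X$), the vectors $\mathbb I_C$, $C\in\mathcal A$, form a basis of $\mathbb R^n$, and $\mathbb I_D\notin\mathrm{cone}(\mathcal A)$ for every set $D\notin\mathcal A$ of the form $\{y\}$ or $\{y\}^c$. A maximal chain is a collection $\{A_0,\dots,A_n\}$ of subsets of $\mathcal X$ with $\emptyset=A_0\subset A_1\subset\dots\subset A_n=\mathcal X$ and $|A_{i+1}\setminus A_i|=1$.
   Formalization: In (vii), "belongs to at most n−2 cones N(x,A,B)" is replaced by "belongs to the relative interior of at most n−2 such cones"; as written it fails, e.g. a constant f lies in every N(x,A,B) (six cones for n=3, while n−2=1). *)

theory Defs
  imports "HOL-Analysis.Analysis" "HOL-Probability.Probability_Mass_Function"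
begin

text \<open>
  The finite set on which everything lives is the universe of a finite type \<open>'n\<close>, so that
  a real function on it is a vector of \<^typ>\<open>real ^ 'n\<close> and the dimension is \<open>CARD('n)\<close>.
\<close>

definition ind_vec :: "'n::finite set \<Rightarrow> real ^ 'n" where
  "ind_vec C = (\<chi> y. indicator C y)"


subsection \<open>Probability intervals and normal cones of credal sets\<close>

definition pri_model :: "('n \<Rightarrow> real) \<Rightarrow> ('n \<Rightarrow> real) \<Rightarrow> bool" where
  "pri_model l u \<longleftrightarrow> (\<forall>x. l x \<le> u x)"

definition credal_set :: "('n \<Rightarrow> real) \<Rightarrow> ('n \<Rightarrow> real) \<Rightarrow> 'n pmf set" where
  "credal_set l u = {P. \<forall>x. l x \<le> pmf P x \<and> pmf P x \<le> u x}"

definition is_minimum :: "real \<Rightarrow> real set \<Rightarrow> bool" where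
  "is_minimum m S \<longleftrightarrow> m \<in> S \<and> (\<forall>s\<in>S. m \<le> s)"

definition is_maximum :: "real \<Rightarrow> real set \<Rightarrow> bool" where
  "is_maximum m S \<longleftrightarrow> m \<in> S \<and> (\<forall>s\<in>S. s \<le> m)"

definition coherent :: "('n \<Rightarrow> real) \<Rightarrow> ('n \<Rightarrow> real) \<Rightarrow> bool" where
  "coherent l u \<longleftrightarrow> credal_set l u \<noteq> {} \<and>
     (\<forall>x. is_minimum (l x) ((\<lambda>P. pmf P x) ` credal_set l u) \<and>
          is_maximum (u x) ((\<lambda>P. pmf P x) ` credal_set l u))"

definition expec :: "'n::finite pmf \<Rightarrow> real ^ 'n \<Rightarrow> real" where
  "expec P f = (\<Sum>x\<in>UNIV. pmf P x * f $ x)"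

definition normal_cone_of :: "(real ^ 'n::finite) set \<Rightarrow> 'n pmf set \<Rightarrow> bool" where
  "normal_cone_of K M \<longleftrightarrow> (\<exists>P\<in>M. K = {f. \<forall>Q\<in>M. expec P f \<le> expec Q f})"


subsection \<open>Cones generated by collections of sets\<close>

definition set_cone :: "'n::finite set set \<Rightarrow> (real ^ 'n) set" where
  "set_cone \<A> =
     {(\<Sum>C\<in>\<A> - {UNIV}. \<alpha> C *\<^sub>R ind_vec C) + \<beta> *\<^sub>R ind_vec UNIV | \<alpha> \<beta>.
        \<forall>C\<in>\<A> - {UNIV}. (0::real) \<le> \<alpha> C}"

definition elementary_sets :: "'n set set" where
  "elementary_sets = {{y} | y. True} \<union> {- {y} | y. True}"

text \<open>
  Since \<^const>\<open>ind_vec\<close> is injective, it does not matter whether the basis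
  is taken as a family or as a set.
\<close>
definition mesc :: "(real ^ 'n::finite) set \<Rightarrow> bool" where
  "mesc K \<longleftrightarrow> (\<exists>\<A> :: 'n set set.
     K = set_cone \<A> \<and>
     UNIV \<in> \<A> \<and> \<A> \<subseteq> insert UNIV elementary_sets \<and>
     independent (ind_vec ` \<A>) \<and> span (ind_vec ` \<A>) = UNIV \<and>
     (\<forall>D\<in>elementary_sets. D \<notin> \<A> \<longrightarrow> ind_vec D \<notin> set_cone \<A>))"

definition maximal_chain :: "'n::finite set set \<Rightarrow> bool" where
  "maximal_chain \<A> \<longleftrightarrow> (\<exists>a :: nat \<Rightarrow> 'n set.
     \<A> = a ` {0..CARD('n)} \<and> a 0 = {} \<and> a (CARD('n)) = UNIV \<and>
     (\<forall>i<CARD('n). a i \<subset> a (Suc i) \<and> card (a (Suc i) - a i) = 1))"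


subsection \<open>The cones \<open>N(x, A, B)\<close>\<close>

definition admissible :: "'n \<Rightarrow> 'n set \<Rightarrow> 'n set \<Rightarrow> bool" where
  "admissible x A B \<longleftrightarrow> A \<noteq> {} \<and> B \<noteq> {} \<and> A \<inter> B = {} \<and> x \<notin> A \<union> B"

definition N :: "'n::finite \<Rightarrow> 'n set \<Rightarrow> 'n set \<Rightarrow> (real ^ 'n) set" where
  "N x A B = {f. (\<forall>y\<in>A. f $ y \<le> f $ x) \<and> (\<forall>z\<in>B. f $ z \<ge> f $ x) \<and>
                 (\<forall>w\<in>- (A \<union> B). f $ w = f $ x)}"

definition above_set :: "real ^ 'n::finite \<Rightarrow> 'n \<Rightarrow> 'n set" where
  "above_set f x = {y. f $ y > f $ x}"

definition below_set :: "real ^ 'n::finite \<Rightarrow> 'n \<Rightarrow> 'n set" where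
  "below_set f x = {y. f $ y < f $ x}"

end

theory Submission
  imports Defs
begin

text \<open>
  Every element of the relative interior of \<open>N x A B\<close> orders each point strictly against \<open>x\<close>,
  so it determines \<open>A\<close> and \<open>B\<close>. Likewise any two points are strictly ordered, in the same way, by
  all vectors in the relative interior of the cone of a maximal chain, because the chain separates
  them. The credal set realising \<open>N x A B\<close> consists of perturbations of the uniform distribution
  that may only remove mass from \<open>A\<close>, only add mass to \<open>B\<close>, and are otherwise two-sided.
\<close>

section \<open>Convexity and relative interior of \<open>N x A B\<close>\<close>

lemma ind_vec_nth [simp]: "ind_vec C $ y = indicator C y"
  by (simp add: ind_vec_def)

lemma convex_cone_N: "convex_cone (N x A B)"
proof -
  have "0 \<in> N x A B" by (simp add: N_def)
  moreover have "u + v \<in> N x A B" if "u \<in> N x A B" "v \<in> N x A B" for u v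
    using that by (auto simp: N_def intro: add_mono)
  moreover have "c *\<^sub>R u \<in> N x A B" if "u \<in> N x A B" "0 \<le> c" for u c
    using that by (auto simp: N_def intro: mult_left_mono)
  ultimately show ?thesis
    unfolding convex_cone_iff by blast
qed

lemma convex_N: "convex (N x A B)"
  using convex_cone_N by (auto simp: convex_cone_def)

text \<open>The source of all strict inequalities below: a segment from \<open>g\<close> to a
  relatively interior \<open>f\<close> can be pushed slightly beyond \<open>f\<close>. If
  \<open>g\<close> satisfies some inequality strictly, the pushed point can satisfy it only if
  \<open>f\<close> has slack there too.\<close>

lemma rel_interior_prolong:
  fixes S :: "'a::euclidean_space set"
  assumes "convex S" "f \<in> rel_interior S" "g \<in> S"
  obtains e where "e > 1" "(1 - e) *\<^sub>R g + e *\<^sub>R f \<in> S"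
proof -
  have "S \<noteq> {}" using assms(3) by blast
  then show thesis
    using assms that convex_rel_interior_iff[of S f] by metis
qed

lemma strict_point_in_N:
  assumes "admissible x A B"
  shows "ind_vec B - ind_vec A \<in> N x A B"
  using assms by (auto simp: N_def admissible_def indicator_def)

text \<open>The strict set is contained in the cone and relatively open in its affine hull, which
  gives one inclusion. Prolonging from a point where every inequality is strict gives the
  other.\<close>

lemma rel_interior_N:
  assumes "admissible x A B"
  shows "rel_interior (N x A B) =
    {f. (\<forall>y\<in>A. f $ y < f $ x) \<and> (\<forall>z\<in>B. f $ z > f $ x) \<and> (\<forall>w\<in>- (A \<union> B). f $ w = f $ x)}"
    (is "_ = ?T")
proof
  let ?U = "{f :: real ^ 'a. (\<forall>y\<in>A. f $ y < f $ x) \<and> (\<forall>z\<in>B. f $ z > f $ x)}"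
  let ?L = "{f :: real ^ 'a. \<forall>w\<in>- (A \<union> B). f $ w = f $ x}"
  have "?U = (\<Inter>y\<in>A. {f. f $ y < f $ x}) \<inter> (\<Inter>z\<in>B. {f. f $ x < f $ z})" by auto
  then have U: "open ?U"
    by (simp only:) (intro open_Int open_INT ballI finite open_Collect_less continuous_intros)
  have "affine ?L"
    by (auto simp: affine_def)
  moreover have "N x A B \<subseteq> ?L" unfolding N_def by blast
  ultimately have hull: "affine hull N x A B \<subseteq> ?L" by (rule hull_minimal[rotated])
  have "?T \<subseteq> N x A B" unfolding N_def using less_imp_le by blast
  \<comment> \<open>The equalities hold on the whole affine hull, so inside it only the finitely
    many strict, hence open, conditions remain.\<close>
  have "?T = affine hull N x A B \<inter> ?U"
    using hull \<open>?T \<subseteq> N x A B\<close> hull_subset[of "N x A B" affine] by blast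
  then have "openin (top_of_set (affine hull N x A B)) ?T"
    using openin_open_Int[OF U] by (simp only:)
  then show "?T \<subseteq> rel_interior (N x A B)"
    using \<open>?T \<subseteq> N x A B\<close> by (rule rel_interior_maximal[rotated])
next
  show "rel_interior (N x A B) \<subseteq> ?T"
  proof
    fix f assume f: "f \<in> rel_interior (N x A B)"
    let ?g = "ind_vec B - ind_vec A"
    have disj: "A \<inter> B = {}" "x \<notin> A" "x \<notin> B" using assms by (auto simp: admissible_def)
    have "f \<in> N x A B" using f rel_interior_subset by blast
    \<comment> \<open>The reference point is -1 on \<open>A\<close>, 1 on \<open>B\<close> and 0 at
      \<open>x\<close>, so each inequality holds there with gap 1. Beyond \<open>f\<close> this
      leaves a gain of \<open>e - 1\<close> in each comparison.\<close>
    obtain e where "e > 1" and e: "(1 - e) *\<^sub>R ?g + e *\<^sub>R f \<in> N x A B"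
      by (rule rel_interior_prolong[OF convex_N f strict_point_in_N[OF assms]])
    let ?h = "(1 - e) *\<^sub>R ?g + e *\<^sub>R f"
    have le: "?h $ y \<le> ?h $ x" if "y \<in> A" for y using e that unfolding N_def by blast
    have ge: "?h $ x \<le> ?h $ z" if "z \<in> B" for z using e that unfolding N_def by blast
    have "f $ y < f $ x" if "y \<in> A" for y
    proof -
      have "y \<notin> B" using that disj by blast
      then have "(e - 1) + e * f $ y \<le> e * f $ x"
        using le[OF that] that disj by (simp add: algebra_simps)
      with \<open>e > 1\<close> have "e * f $ y < e * f $ x" by linarith
      with \<open>e > 1\<close> show ?thesis by simp
    qed
    moreover have "f $ z > f $ x" if "z \<in> B" for z
    proof -
      have "z \<notin> A" using that disj by blast
      then have "e * f $ x \<le> (1 - e) + e * f $ z"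
        using ge[OF that] that disj by (simp add: algebra_simps)
      with \<open>e > 1\<close> have "e * f $ x < e * f $ z" by linarith
      with \<open>e > 1\<close> show ?thesis by simp
    qed
    ultimately show "f \<in> ?T" using \<open>f \<in> N x A B\<close> by (auto simp: N_def)
  qed
qed

lemma rel_interior_N_iff:
  assumes "admissible x A B"
  shows "f \<in> rel_interior (N x A B) \<longleftrightarrow> A = below_set f x \<and> B = above_set f x"
proof
  assume "f \<in> rel_interior (N x A B)"
  then have *: "\<And>y. y \<in> A \<Longrightarrow> f $ y < f $ x" "\<And>z. z \<in> B \<Longrightarrow> f $ z > f $ x"
    "\<And>w. w \<notin> A \<Longrightarrow> w \<notin> B \<Longrightarrow> f $ w = f $ x"
    by (auto simp: rel_interior_N[OF assms])
  show "A = below_set f x \<and> B = above_set f x"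
    unfolding below_set_def above_set_def set_eq_iff mem_Collect_eq
    using * by (metis less_asym less_irrefl)
next
  assume "A = below_set f x \<and> B = above_set f x"
  then show "f \<in> rel_interior (N x A B)"
    unfolding rel_interior_N[OF assms] by (auto simp: below_set_def above_set_def)
qed

lemma admissible_below_above:
  assumes "below_set f y \<noteq> {}" "above_set f y \<noteq> {}"
  shows "admissible y (below_set f y) (above_set f y)"
  using assms by (auto simp: admissible_def below_set_def above_set_def)

section \<open>Faces\<close>

text \<open>Shrinking \<open>A\<close> and \<open>B\<close> turns some inequalities into equalities.
  If such an equality holds at an interior point of a segment in the large cone, the deviations at
  the two endpoints have the same sign and positive weights, and their weighted sum is zero, so both
  vanish.\<close>

lemma N_face_of:
  assumes "admissible x A B" "A' \<subseteq> A" "B' \<subseteq> B"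
  shows "N x A' B' face_of N x A B"
  unfolding face_of_def
proof (intro conjI ballI impI)
  \<comment> \<open>Disjointness of \<open>A\<close> and \<open>B\<close> matters here: a point
    dropped from one of them cannot return through the other.\<close>
  have w: "w \<in> - (A' \<union> B')" if "w \<in> A \<and> w \<notin> A' \<or> w \<in> B \<and> w \<notin> B' \<or> w \<notin> A \<union> B" for w
    using that assms by (auto simp: admissible_def)
  show "N x A' B' \<subseteq> N x A B"
  proof
    fix f assume f: "f \<in> N x A' B'"
    have "f $ y \<le> f $ x" if "y \<in> A" for y
      using f w[of y] that by (cases "y \<in> A'") (auto simp: N_def)
    moreover have "f $ z \<ge> f $ x" if "z \<in> B" for z
      using f w[of z] that by (cases "z \<in> B'") (auto simp: N_def)
    ultimately show "f \<in> N x A B" using f w unfolding N_def by blast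
  qed
  show "convex (N x A' B')" by (rule convex_N)
  fix a b f
  assume a: "a \<in> N x A B" and b: "b \<in> N x A B" and f: "f \<in> N x A' B'"
    and "f \<in> open_segment a b"
  then obtain t where t: "0 < t" "t < 1" "f = (1 - t) *\<^sub>R a + t *\<^sub>R b"
    by (auto simp: in_segment)
  have *: "a $ v = a $ x \<and> b $ v = b $ x" if v: "v \<in> - (A' \<union> B')" for v
  proof -
    have eq: "(1 - t) * (a $ v - a $ x) + t * (b $ v - b $ x) = 0"
      using f v t(3) by (auto simp: N_def algebra_simps)
    consider "v \<in> A" | "v \<in> B" | "v \<notin> A \<union> B" by blast
    then show ?thesis
    proof cases
      case 1
      then have "(1 - t) * (a $ v - a $ x) \<le> 0" "t * (b $ v - b $ x) \<le> 0"
        using a b t by (auto simp: N_def mult_le_0_iff)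
      with eq t show ?thesis by (smt (verit) mult_eq_0_iff)
    next
      case 2
      then have "(1 - t) * (a $ v - a $ x) \<ge> 0" "t * (b $ v - b $ x) \<ge> 0"
        using a b t by (auto simp: N_def zero_le_mult_iff)
      with eq t show ?thesis by (smt (verit) mult_eq_0_iff)
    next
      case 3
      then show ?thesis using a b by (auto simp: N_def)
    qed
  qed
  show "a \<in> N x A' B'" "b \<in> N x A' B'"
    using a b assms * by (auto simp: N_def)
qed

section \<open>Counting the cones that contain a vector\<close>

text \<open>Membership is counted in relative interiors, since a constant vector lies in every
  \<open>N y C D\<close>. Relative interior membership fixes \<open>C\<close> and \<open>D\<close>
  from \<open>y\<close>, so there are at most as many cones as points \<open>y\<close> with values
  of \<open>f\<close> on both sides of \<open>f $ y\<close>; a minimiser and a maximiser of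
  \<open>f\<close> are not among these points.\<close>

lemma card_cones_le:
  fixes f :: "real ^ 'n::finite"
  defines "S \<equiv> {N y C D | y C D. admissible y C D \<and> f \<in> rel_interior (N y C D)}"
  shows "finite S \<and> card S \<le> CARD('n) - 2"
proof -
  let ?I = "{y. below_set f y \<noteq> {} \<and> above_set f y \<noteq> {}}"
  have "S \<subseteq> (\<lambda>y. N y (below_set f y) (above_set f y)) ` ?I"
  proof
    fix K assume "K \<in> S"
    then obtain y C D where "K = N y C D" and ad: "admissible y C D"
      and "f \<in> rel_interior (N y C D)"
      by (auto simp: S_def)
    moreover from this have "C = below_set f y" "D = above_set f y"
      by (auto simp: rel_interior_N_iff)
    ultimately show "K \<in> (\<lambda>y. N y (below_set f y) (above_set f y)) ` ?I"
      by (auto simp: admissible_def)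
  qed
  then have fin: "finite S" and "card S \<le> card ?I"
    by (auto intro: finite_subset surj_card_le)
  moreover have "card ?I \<le> CARD('n) - 2"
  proof (cases "?I = {}")
    case True
    then show ?thesis by (simp only: card.empty)
  next
    case False
    obtain a where a: "\<And>v. f $ a \<le> f $ v"
      using arg_min_least[of UNIV _ "($) f"] by (metis UNIV_I UNIV_not_empty finite)
    obtain b where b: "\<And>v. f $ v \<le> f $ b"
      using arg_min_least[of UNIV _ "\<lambda>v. - f $ v"] by (metis UNIV_I UNIV_not_empty finite neg_le_iff_le)
    \<comment> \<open>A point of \<open>?I\<close> has values strictly below and strictly above its
      own, so \<open>f\<close> is not constant and two distinct points are excluded.\<close>
    have "a \<noteq> b"
      using False a b unfolding below_set_def above_set_def by (metis (mono_tags, lifting) empty_Collect_eq leD order.strict_trans2)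
    moreover have "?I \<subseteq> - {a, b}"
      using a b unfolding below_set_def above_set_def by (auto simp: not_less dest: leD)
    then have "card ?I \<le> card (- {a, b})" by (rule card_mono[rotated]) simp
    ultimately show ?thesis by (simp add: Compl_eq_Diff_UNIV card_Diff_subset)
  qed
  ultimately show ?thesis by simp
qed

section \<open>Cones generated by collections of sets\<close>

lemma set_coneI:
  assumes "\<And>C. C \<in> \<A> - {UNIV} \<Longrightarrow> 0 \<le> \<alpha> C"
  shows "(\<Sum>C\<in>\<A> - {UNIV}. \<alpha> C *\<^sub>R ind_vec C) + \<beta> *\<^sub>R ind_vec UNIV \<in> set_cone \<A>"
  using assms unfolding set_cone_def by blast

lemma ind_vec_in_set_cone:
  assumes "C \<in> \<A>"
  shows "ind_vec C \<in> set_cone \<A>"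
proof (cases "C = UNIV")
  case True
  then show ?thesis using set_coneI[of \<A> "\<lambda>_. 0" 1] by simp
next
  case False
  have "(\<Sum>D\<in>\<A> - {UNIV}. of_bool (D = C) *\<^sub>R ind_vec D) = (ind_vec C :: real ^ 'a)"
    using assms False by (simp add: of_bool_def if_distrib[of "\<lambda>r. r *\<^sub>R _"] sum.delta cong: if_cong)
  then show ?thesis using set_coneI[of \<A> "\<lambda>D. of_bool (D = C)" 0] by simp
qed

lemma convex_set_cone: "convex (set_cone \<A>)"
  unfolding convex_def
proof (intro ballI allI impI)
  fix f g and s t :: real
  assume "f \<in> set_cone \<A>" "g \<in> set_cone \<A>" and st: "0 \<le> s" "0 \<le> t"
  then obtain \<alpha> \<beta> \<alpha>' \<beta>' where
    f: "f = (\<Sum>C\<in>\<A> - {UNIV}. \<alpha> C *\<^sub>R ind_vec C) + \<beta> *\<^sub>R ind_vec UNIV"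
      "\<forall>C\<in>\<A> - {UNIV}. 0 \<le> \<alpha> C"
    and g: "g = (\<Sum>C\<in>\<A> - {UNIV}. \<alpha>' C *\<^sub>R ind_vec C) + \<beta>' *\<^sub>R ind_vec UNIV"
      "\<forall>C\<in>\<A> - {UNIV}. 0 \<le> \<alpha>' C"
    unfolding set_cone_def by blast
  have "s *\<^sub>R f + t *\<^sub>R g =
    (\<Sum>C\<in>\<A> - {UNIV}. (s * \<alpha> C + t * \<alpha>' C) *\<^sub>R ind_vec C) + (s * \<beta> + t * \<beta>') *\<^sub>R ind_vec UNIV"
    by (simp add: f(1) g(1) scaleR_right_distrib scaleR_left_distrib scaleR_sum_right sum.distrib)
  then show "s *\<^sub>R f + t *\<^sub>R g \<in> set_cone \<A>"
    using f(2) g(2) st by (simp only: set_coneI add_nonneg_nonneg mult_nonneg_nonneg)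
qed

text \<open>Each generating indicator is at most as large at \<open>y\<close> as at
  \<open>z\<close>, nonnegative weights preserve this, and the free \<open>\<beta>\<close> term adds
  the same amount to both coordinates.\<close>

lemma set_cone_mono_nth:
  assumes "f \<in> set_cone \<A>" "\<And>C. C \<in> \<A> \<Longrightarrow> y \<in> C \<Longrightarrow> z \<in> C"
  shows "f $ y \<le> f $ z"
proof -
  obtain \<alpha> \<beta> where f: "f = (\<Sum>C\<in>\<A> - {UNIV}. \<alpha> C *\<^sub>R ind_vec C) + \<beta> *\<^sub>R ind_vec UNIV"
      "\<forall>C\<in>\<A> - {UNIV}. 0 \<le> \<alpha> C"
    using assms(1) unfolding set_cone_def by blast
  have "(\<Sum>C\<in>\<A> - {UNIV}. \<alpha> C * indicator C y) \<le> (\<Sum>C\<in>\<A> - {UNIV}. \<alpha> C * indicator C z)"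
    by (intro sum_mono mult_left_mono) (use f(2) assms(2) in \<open>auto simp: indicator_def\<close>)
  then show ?thesis by (simp add: f(1))
qed

text \<open>Prolonging from the generator \<open>ind_vec C\<close>, which is 0 at \<open>y\<close>
  and 1 at \<open>z\<close>, makes the previous comparison strict.\<close>

lemma rel_interior_set_cone_strict:
  assumes "f \<in> rel_interior (set_cone \<A>)"
    and "\<And>C. C \<in> \<A> \<Longrightarrow> y \<in> C \<Longrightarrow> z \<in> C"
    and "C \<in> \<A>" "z \<in> C" "y \<notin> C"
  shows "f $ y < f $ z"
proof -
  obtain e where "e > 1" and e: "(1 - e) *\<^sub>R ind_vec C + e *\<^sub>R f \<in> set_cone \<A>"
    by (rule rel_interior_prolong[OF convex_set_cone assms(1) ind_vec_in_set_cone[OF assms(3)]])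
  have "e * f $ y \<le> (1 - e) + e * f $ z"
    using set_cone_mono_nth[OF e, of y z] assms(2,4,5) by simp
  with \<open>e > 1\<close> have "e * f $ y < e * f $ z" by linarith
  with \<open>e > 1\<close> show ?thesis by simp
qed

section \<open>Maximal chains\<close>

text \<open>The chain starts empty and ends with everything, so there is a first step at which it
  catches \<open>y\<close> or \<open>z\<close>; each step adds only one element, so it cannot catch
  both at once.\<close>

lemma maximal_chain_separates:
  assumes "maximal_chain \<A>" "y \<noteq> z"
  shows "\<exists>C\<in>\<A>. (y \<in> C) \<noteq> (z \<in> C)"
proof -
  obtain a :: "nat \<Rightarrow> 'a set" where a: "\<A> = a ` {0..CARD('a)}" "a 0 = {}" "a CARD('a) = UNIV"
    and step: "\<And>i. i < CARD('a) \<Longrightarrow> card (a (Suc i) - a i) = 1"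
    using assms(1) unfolding maximal_chain_def by blast
  define P where "P = (\<lambda>i. y \<in> a i \<or> z \<in> a i)"
  have "\<exists>k<CARD('a). (\<forall>i\<le>k. \<not> P i) \<and> P (Suc k)"
    using ex_least_nat_less[of P "CARD('a)"] a by (simp add: P_def)
  then obtain k where k: "k < CARD('a)" "\<not> P k" "P (Suc k)" by blast
  obtain v where "a (Suc k) - a k = {v}"
    using step[OF k(1)] by (auto simp: card_1_singleton_iff)
  then have "(y \<in> a (Suc k)) \<noteq> (z \<in> a (Suc k))"
    using k assms(2) unfolding P_def by (metis DiffI singletonD)
  then show ?thesis using a(1) k(1) by auto
qed

lemma maximal_chain_linear:
  assumes "maximal_chain \<A>" "C \<in> \<A>" "D \<in> \<A>"
  shows "C \<subseteq> D \<or> D \<subseteq> C"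
proof -
  obtain a :: "nat \<Rightarrow> 'a set" where a: "\<A> = a ` {0..CARD('a)}"
    and chain: "\<forall>i<CARD('a). a i \<subset> a (Suc i) \<and> card (a (Suc i) - a i) = 1"
    using assms(1) unfolding maximal_chain_def by (elim exE conjE)
  have mono: "a i \<subseteq> a j" if "i \<le> j" "j \<le> CARD('a)" for i j
    using that
  proof (induction rule: dec_induct)
    case (step n)
    then have "a i \<subseteq> a n" "a n \<subset> a (Suc n)" using chain by simp_all
    then show ?case by blast
  qed simp
  obtain i j where "C = a i" "i \<le> CARD('a)" "D = a j" "j \<le> CARD('a)"
    using assms(2,3) unfolding a by auto
  then show ?thesis using mono[of i j] mono[of j i] by (cases "i \<le> j") simp_all
qed

lemma maximal_chain_order:
  assumes "maximal_chain \<A>" "y \<noteq> z"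
  shows "(\<forall>f\<in>rel_interior (set_cone \<A>). f $ y < f $ z) \<or>
         (\<forall>f\<in>rel_interior (set_cone \<A>). f $ z < f $ y)"
proof -
  have *: "\<forall>f\<in>rel_interior (set_cone \<A>). f $ v < f $ w"
    if "C \<in> \<A>" "w \<in> C" "v \<notin> C" for C v w
  proof
    fix f assume "f \<in> rel_interior (set_cone \<A>)"
    \<comment> \<open>A member containing \<open>v\<close> is not contained in \<open>C\<close>, so
      by linearity it contains \<open>C\<close> and hence \<open>w\<close>.\<close>
    moreover have "w \<in> D" if "D \<in> \<A>" "v \<in> D" for D
      using maximal_chain_linear[OF assms(1) \<open>C \<in> \<A>\<close> \<open>D \<in> \<A>\<close>] that \<open>w \<in> C\<close> \<open>v \<notin> C\<close> by blast
    ultimately show "f $ v < f $ w"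
      using that by (rule rel_interior_set_cone_strict)
  qed
  obtain C where "C \<in> \<A>" "(y \<in> C) \<noteq> (z \<in> C)"
    using maximal_chain_separates[OF assms] by blast
  then show ?thesis using *[of C z y] *[of C y z] by blast
qed

text \<open>\<open>N x A B\<close> is described by coordinate comparisons alone, and all vectors of
  the relative interior agree on every such comparison. Hence one of them lies in
  \<open>N x A B\<close> only if all do.\<close>

lemma maximal_chain_cone_N:
  assumes "maximal_chain \<A>" "admissible x A B"
  shows "rel_interior (set_cone \<A>) \<subseteq> N x A B \<or> rel_interior (set_cone \<A>) \<inter> N x A B = {}"
proof (rule disjCI)
  let ?R = "rel_interior (set_cone \<A>)"
  assume "?R \<inter> N x A B \<noteq> {}"
  then obtain f where fR: "f \<in> ?R" and f: "f \<in> N x A B" by blast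
  have order: "g $ v < g $ w \<longleftrightarrow> f $ v < f $ w" if "g \<in> ?R" for g v w
    using maximal_chain_order[OF assms(1), of v w] that fR by (cases "v = w") force+
  show "?R \<subseteq> N x A B"
  proof
    fix g assume "g \<in> ?R"
    from order[OF this] have "g $ v \<le> g $ w \<longleftrightarrow> f $ v \<le> f $ w" for v w
      by (metis not_less)
    then show "g \<in> N x A B"
      using f unfolding N_def by (simp add: order_eq_iff)
  qed
qed

section \<open>Realisation as a normal cone of a coherent model\<close>

lemma pmf_of_finite_function:
  fixes p :: "'n::finite \<Rightarrow> real"
  assumes "\<And>v. 0 \<le> p v" "(\<Sum>v\<in>UNIV. p v) = 1"
  obtains P where "pmf P = p"
proof
  have "(\<integral>\<^sup>+ v. ennreal (p v) \<partial>count_space UNIV) = 1"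
    using assms by (simp add: nn_integral_count_space_finite sum_ennreal)
  then show "pmf (embed_pmf p) = p"
    using assms by (intro ext pmf_embed_pmf)
qed

lemma sum_pmf_finite_UNIV: "(\<Sum>v\<in>UNIV. pmf (P :: 'n::finite pmf) v) = 1"
  by (rule sum_pmf_eq_1) auto

text \<open>The normal cone is taken at the uniform distribution. Moving mass from \<open>s\<close>
  to \<open>t\<close> tests the inequality \<open>f $ s \<le> f $ t\<close>, and the bounds are
  chosen so that the permitted moves test exactly the inequalities of
  \<open>N x A B\<close>.\<close>

lemma N_normal_cone:
  fixes x :: "'n::finite"
  assumes "admissible x A B"
  shows "\<exists>l u. pri_model l u \<and> coherent l u \<and> normal_cone_of (N x A B) (credal_set l u)"
proof -
  define e where "e = 1 / real CARD('n)"
  \<comment> \<open>Around the uniform mass \<open>e\<close>, every point may lose or gain up to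
    \<open>e\<close>, except that points of \<open>B\<close> may not lose and points of
    \<open>A\<close> may not gain.\<close>
  define l where "l v = (if v \<in> B then e else 0)" for v
  define u where "u v = (if v \<in> A then e else 2 * e)" for v
  let ?M = "credal_set l u"
  have e: "e > 0" by (simp add: e_def)
  have disj: "A \<inter> B = {}" "x \<notin> A" "x \<notin> B" using assms by (auto simp: admissible_def)
  obtain a b where ab: "a \<in> A" "b \<in> B" using assms by (auto simp: admissible_def)
  have sum1: "(\<Sum>v\<in>(UNIV :: 'n set). e) = 1" by (simp add: e_def)
  have lu: "l v \<le> u v" for v using e disj by (auto simp: l_def u_def)
  \<comment> \<open>Moving the full mass \<open>e\<close> from \<open>s\<close> to \<open>t\<close>
    serves twice: for \<open>s \<noteq> t\<close> it attains the lower bound at \<open>s\<close> and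
    the upper bound at \<open>t\<close>, and it supplies the test directions for the normal
    cone.\<close>
  have transfer: "\<exists>Q\<in>?M. \<forall>w. pmf Q w = e + e * of_bool (w = t) - e * of_bool (w = s)"
    if "s \<notin> B" "t \<notin> A" for s t
  proof -
    have "(\<Sum>w\<in>(UNIV :: 'n set). e + e * of_bool (w = t) - e * of_bool (w = s)) = 1"
      using sum1 by (simp add: sum.distrib sum_subtractf flip: sum_distrib_left)
    moreover have "0 \<le> e + e * of_bool (w = t) - e * of_bool (w = s)" for w
      using e by (cases "w = t"; cases "w = s") simp_all
    ultimately obtain Q where Q: "pmf Q = (\<lambda>w. e + e * of_bool (w = t) - e * of_bool (w = s))"
      using pmf_of_finite_function[of "\<lambda>w. e + e * of_bool (w = t) - e * of_bool (w = s)"] by blast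
    moreover have "Q \<in> ?M"
      using that e disj by (auto simp: credal_set_def Q l_def u_def of_bool_def)
    ultimately show ?thesis by (intro bexI[of _ Q]) simp_all
  qed
  obtain P where P: "P \<in> ?M" "\<And>w. pmf P w = e"
  proof -
    \<comment> \<open>With \<open>s = t = x\<close> nothing moves, which gives the uniform
      distribution.\<close>
    from transfer[OF disj(3,2)] that show thesis by (auto simp only: add_diff_cancel_right')
  qed
  have low: "\<exists>Q\<in>?M. pmf Q v = l v" for v
  proof (cases "v \<in> B")
    case True
    then show ?thesis using P by (auto simp: l_def)
  next
    case False
    \<comment> \<open>Both \<open>x\<close> and \<open>b\<close> lie outside \<open>A\<close>, and
      at least one of them differs from \<open>v\<close>. The upper bounds use \<open>x\<close> and
      \<open>a\<close> outside \<open>B\<close> in the same way.\<close>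
    have "\<exists>t. t \<notin> A \<and> t \<noteq> v" using disj ab by (metis disjoint_iff)
    then obtain t where t: "t \<notin> A" "t \<noteq> v" by blast
    obtain Q where "Q \<in> ?M" "pmf Q v = e + e * of_bool (v = t) - e * of_bool (v = v)"
      using transfer[OF False t(1)] by blast
    then show ?thesis using False t by (intro bexI[of _ Q]) (simp_all add: l_def)
  qed
  have upp: "\<exists>Q\<in>?M. pmf Q v = u v" for v
  proof (cases "v \<in> A")
    case True
    then show ?thesis using P by (auto simp: u_def)
  next
    case False
    have "\<exists>s. s \<notin> B \<and> s \<noteq> v" using disj ab by (metis disjoint_iff)
    then obtain s where s: "s \<notin> B" "s \<noteq> v" by blast
    obtain Q where "Q \<in> ?M" "pmf Q v = e + e * of_bool (v = v) - e * of_bool (v = s)"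
      using transfer[OF s(1) False] by blast
    then show ?thesis using False s by (intro bexI[of _ Q]) (simp_all add: u_def)
  qed
  have "coherent l u"
    unfolding coherent_def is_minimum_def is_maximum_def
  proof (intro conjI allI ballI)
    show "?M \<noteq> {}" using P(1) by blast
    fix v
    show "l v \<in> (\<lambda>P. pmf P v) ` ?M" using low[of v] by force
    show "u v \<in> (\<lambda>P. pmf P v) ` ?M" using upp[of v] by force
  qed (auto simp: credal_set_def)
  moreover have "N x A B = {f. \<forall>Q\<in>?M. expec P f \<le> expec Q f}"
  proof (intro subset_antisym subsetI CollectI ballI)
    fix f Q assume f: "f \<in> N x A B" and Q: "Q \<in> ?M"
    \<comment> \<open>Both distributions have total mass 1, so subtracting the constant
      \<open>f $ x\<close> leaves the difference of expectations unchanged and makes every summand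
      nonnegative.\<close>
    have "0 \<le> (\<Sum>v\<in>UNIV. (pmf Q v - e) * (f $ v - f $ x))"
    proof (rule sum_nonneg)
      fix v
      have bounds: "l v \<le> pmf Q v" "pmf Q v \<le> u v" using Q by (auto simp: credal_set_def)
      consider "v \<in> A" | "v \<in> B" | "v \<in> - (A \<union> B)" by blast
      then show "0 \<le> (pmf Q v - e) * (f $ v - f $ x)"
      proof cases
        case 1
        then show ?thesis using f bounds
          by (intro mult_nonpos_nonpos) (auto simp: N_def u_def)
      next
        case 2
        then show ?thesis using f bounds
          by (intro mult_nonneg_nonneg) (auto simp: N_def l_def)
      next
        case 3
        then have "f $ v = f $ x" using f by (simp add: N_def)
        then show ?thesis by simp
      qed
    qed
    also have "\<dots> = (expec Q f - expec P f) - f $ x * ((\<Sum>v\<in>UNIV. pmf Q v) - (\<Sum>v\<in>(UNIV :: 'n set). e))"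
      by (simp add: expec_def P(2) algebra_simps sum.distrib sum_subtractf sum_distrib_left)
    also have "\<dots> = expec Q f - expec P f" by (simp only: sum_pmf_finite_UNIV sum1) simp
    finally show "expec P f \<le> expec Q f" by simp
  next
    fix f assume "f \<in> {f. \<forall>Q\<in>?M. expec P f \<le> expec Q f}"
    then have f: "\<And>Q. Q \<in> ?M \<Longrightarrow> expec P f \<le> expec Q f" by blast
    have le: "f $ s \<le> f $ t" if st: "s \<notin> B" "t \<notin> A" for s t
    proof -
      obtain Q where Q: "Q \<in> ?M" "\<And>w. pmf Q w = e + e * of_bool (w = t) - e * of_bool (w = s)"
        using transfer[OF st] by blast
      have "expec Q f = (\<Sum>w\<in>UNIV. e * f $ w + (if w = t then e * f $ w else 0) - (if w = s then e * f $ w else 0))"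
        unfolding expec_def Q(2) by (rule sum.cong) (auto simp: algebra_simps)
      also have "\<dots> = expec P f + e * f $ t - e * f $ s"
        by (simp add: expec_def P(2) sum.distrib sum_subtractf)
      finally show ?thesis using f[OF Q(1)] e by simp
    qed
    \<comment> \<open>Take \<open>t = x\<close> for points of \<open>A\<close>, \<open>s = x\<close>
      for points of \<open>B\<close>, and both choices for the remaining points.\<close>
    then show "f \<in> N x A B" using disj by (auto simp: N_def intro!: antisym)
  qed
  ultimately show ?thesis
    using lu P(1) unfolding pri_model_def normal_cone_of_def by blast
qed

section \<open>Maximal elementary simplicial cones\<close>

text \<open>A further point \<open>w\<close> outside \<open>A \<union> B\<close> confines the cone
  to the hyperplane \<open>f $ w = f $ x\<close>, whereas the generators of an MESC span the whole
  space.\<close>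

lemma mesc_imp_cover:
  assumes "mesc (N x A B)" "admissible x A B"
  shows "A \<union> B = - {x}"
proof (rule ccontr)
  assume "A \<union> B \<noteq> - {x}"
  then obtain w where w: "w \<noteq> x" "w \<notin> A \<union> B" using assms(2) by (auto simp: admissible_def)
  obtain \<A> where \<A>: "N x A B = set_cone \<A>" "span (ind_vec ` \<A>) = UNIV"
    using assms(1) unfolding mesc_def by blast
  let ?H = "{f :: real ^ 'a. f $ w = f $ x}"
  have "ind_vec ` \<A> \<subseteq> N x A B" unfolding \<A>(1) using ind_vec_in_set_cone by blast
  also have "\<dots> \<subseteq> ?H" using w by (auto simp: N_def)
  finally have "span (ind_vec ` \<A>) \<subseteq> ?H"
    by (rule span_minimal) (auto simp: subspace_def)
  then have "ind_vec {w} \<in> ?H" using \<A>(2) by blast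
  then show False using w(1) by simp
qed

text \<open>Complements of the points of \<open>A\<close> and singletons of the points of
  \<open>B\<close> generate the cone. Measured relative to the value at \<open>x\<close>, the
  generator of \<open>v\<close> is nonzero only in coordinate \<open>v\<close>, with sign
  \<open>s v\<close>, so the coefficients can be read off.\<close>

lemma cover_imp_mesc:
  fixes x :: "'n::finite"
  assumes ad: "admissible x A B" and cover: "A \<union> B = - {x}"
  shows "mesc (N x A B)"
proof -
  define g where "g v = (if v \<in> A then - {v} else {v})" for v :: 'n
  define s where "s v = (if v \<in> A then - 1 else 1 :: real)" for v :: 'n
  define \<A> where "\<A> = insert UNIV (g ` (- {x}))"
  have disj: "A \<inter> B = {}" "x \<notin> A" "x \<notin> B" using ad by (auto simp: admissible_def)
  obtain a b where ab: "a \<in> A" "b \<in> B" using ad by (auto simp: admissible_def)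
  then have abx: "a \<noteq> b" "a \<noteq> x" "b \<noteq> x" using disj by auto
  \<comment> \<open>Membership of \<open>x\<close> tells complements from singletons, which keeps
    \<open>g\<close> injective.\<close>
  have x_in_g: "x \<in> g v \<longleftrightarrow> v \<in> A" if "v \<noteq> x" for v
    using that by (auto simp: g_def)
  have inj: "inj_on g (- {x})"
  proof (rule inj_onI)
    fix v w assume vw: "v \<in> - {x}" "w \<in> - {x}" "g v = g w"
    then have "v \<in> A \<longleftrightarrow> w \<in> A" using x_in_g[of v] x_in_g[of w] by simp
    with vw(3) show "v = w" by (cases "v \<in> A") (simp_all add: g_def)
  qed
  have "g v \<noteq> UNIV" for v
  proof (cases "v \<in> A")
    case False
    have "{a, b} \<noteq> {v}" "a \<notin> {v} \<or> b \<notin> {v}" using abx by auto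
    then show ?thesis using False unfolding g_def by (metis UNIV_I)
  qed (auto simp: g_def)
  then have \<A>': "\<A> - {UNIV} = g ` (- {x})" by (auto simp: \<A>_def)
  have diff: "ind_vec (g v) $ w - ind_vec (g v) $ x = (if w = v then s v else 0)" if "v \<noteq> x" for v w
    using that by (auto simp: g_def s_def indicator_def)
  have expand: "((\<Sum>v\<in>- {x}. c v *\<^sub>R ind_vec (g v)) + \<beta> *\<^sub>R ind_vec UNIV) $ w
      - ((\<Sum>v\<in>- {x}. c v *\<^sub>R ind_vec (g v)) + \<beta> *\<^sub>R ind_vec UNIV) $ x = (if w = x then 0 else s w * c w)"
    for c :: "'n \<Rightarrow> real" and \<beta> w
  proof -
    have "((\<Sum>v\<in>- {x}. c v *\<^sub>R ind_vec (g v)) + \<beta> *\<^sub>R ind_vec UNIV) $ w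
      - ((\<Sum>v\<in>- {x}. c v *\<^sub>R ind_vec (g v)) + \<beta> *\<^sub>R ind_vec UNIV) $ x
      = (\<Sum>v\<in>- {x}. c v * (ind_vec (g v) $ w - ind_vec (g v) $ x))"
      by (simp add: right_diff_distrib sum_subtractf)
    also have "\<dots> = (\<Sum>v\<in>- {x}. if w = v then s w * c w else 0)"
      by (rule sum.cong) (use diff in auto)
    finally show ?thesis by simp
  qed
  have in_N: "f \<in> N x A B \<longleftrightarrow> (\<forall>v\<in>- {x}. 0 \<le> s v * (f $ v - f $ x))" for f
    using disj cover unfolding N_def s_def by (auto simp: algebra_simps split: if_splits)
  have cone: "N x A B = set_cone \<A>"
  proof (intro subset_antisym subsetI)
    fix f assume f: "f \<in> N x A B"
    \<comment> \<open>These coefficients solve \<open>expand\<close> because \<open>s v\<close> is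
      its own inverse; \<open>\<beta>\<close> then corrects the value at \<open>x\<close>.\<close>
    define c where "c v = s v * (f $ v - f $ x)" for v
    define h where "h = (\<Sum>v\<in>- {x}. c v *\<^sub>R ind_vec (g v))"
    define \<beta> where "\<beta> = f $ x - h $ x"
    have "(h + \<beta> *\<^sub>R ind_vec UNIV) $ w = f $ w" for w
      using expand[of c \<beta> w] unfolding h_def[symmetric]
      by (auto simp: \<beta>_def c_def s_def split: if_splits)
    then have f_eq: "f = h + \<beta> *\<^sub>R ind_vec UNIV" by (simp add: vec_eq_iff)
    have h_eq: "h = (\<Sum>C\<in>\<A> - {UNIV}. c (inv_into (- {x}) g C) *\<^sub>R ind_vec C)"
      unfolding \<A>' h_def by (simp add: sum.reindex[OF inj] inv_into_f_f[OF inj])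
    have "0 \<le> c (inv_into (- {x}) g C)" if "C \<in> \<A> - {UNIV}" for C
      using that f in_N unfolding \<A>' by (auto simp: c_def inv_into_f_f[OF inj])
    then show "f \<in> set_cone \<A>" unfolding f_eq h_eq by (rule set_coneI)
  next
    fix f assume "f \<in> set_cone \<A>"
    then obtain \<alpha> \<beta> where f: "f = (\<Sum>v\<in>- {x}. \<alpha> (g v) *\<^sub>R ind_vec (g v)) + \<beta> *\<^sub>R ind_vec UNIV"
      and \<alpha>: "\<And>v. v \<in> - {x} \<Longrightarrow> 0 \<le> \<alpha> (g v)"
      unfolding set_cone_def \<A>' by (auto simp: sum.reindex[OF inj])
    have "s v * (f $ v - f $ x) = \<alpha> (g v)" if "v \<noteq> x" for v
      unfolding f expand using that by (simp add: s_def)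
    then show "f \<in> N x A B" using in_N \<alpha> by simp
  qed
  have "independent (ind_vec ` \<A>)" "span (ind_vec ` \<A>) = UNIV"
  proof -
    let ?S = "span (ind_vec ` \<A>) :: (real ^ 'n) set"
    have gen: "ind_vec C \<in> ?S" if "C \<in> \<A>" for C using that by (simp add: span_base)
    have one: "ind_vec UNIV \<in> ?S" by (rule gen) (simp add: \<A>_def)
    have single: "ind_vec {v} \<in> ?S" if "v \<noteq> x" for v
    proof (cases "v \<in> A")
      case True
      have "ind_vec {v} = (ind_vec UNIV - ind_vec (- {v}) :: real ^ 'n)"
        by (simp add: vec_eq_iff indicator_def)
      moreover have "- {v} \<in> \<A>" using True that by (force simp: \<A>_def g_def)
      ultimately show ?thesis using one gen by (metis span_diff)
    next
      case False
      then have "{v} \<in> \<A>" using that by (force simp: \<A>_def g_def)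
      then show ?thesis by (rule gen)
    qed
    have "f \<in> ?S" for f
    proof -
      have "f = f $ x *\<^sub>R ind_vec UNIV + (\<Sum>v\<in>- {x}. (f $ v - f $ x) *\<^sub>R ind_vec {v})"
      proof (subst vec_eq_iff, rule allI)
        fix w
        have "(\<Sum>v\<in>- {x}. (f $ v - f $ x) *\<^sub>R ind_vec {v}) $ w
            = (\<Sum>v\<in>- {x}. if w = v then f $ w - f $ x else 0)"
          unfolding sum_component by (rule sum.cong) (auto simp: indicator_def)
        then show "f $ w = (f $ x *\<^sub>R ind_vec UNIV + (\<Sum>v\<in>- {x}. (f $ v - f $ x) *\<^sub>R ind_vec {v})) $ w"
          by (simp only: vector_add_component) simp
      qed
      also have "\<dots> \<in> ?S"
        by (intro span_add span_scale span_sum one single) auto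
      finally show ?thesis .
    qed
    then show span: "?S = UNIV" by auto
    \<comment> \<open>Independence follows from spanning: a spanning set with at most
      \<open>CARD('n)\<close> vectors is independent.\<close>
    have "card (ind_vec ` \<A> :: (real ^ 'n) set) \<le> card \<A>" by (simp add: card_image_le)
    also have "\<dots> \<le> Suc (card (g ` (- {x})))" unfolding \<A>_def by (rule card_insert_le_m1) simp_all
    also have "\<dots> \<le> Suc (card (- {x}))" by (simp add: card_image_le)
    also have "\<dots> = CARD('n)" by (simp add: Compl_eq_Diff_UNIV card_Diff_subset)
    finally show "independent (ind_vec ` \<A> :: (real ^ 'n) set)"
      using span by (intro card_le_dim_spanning[of _ UNIV]) auto
  qed
  \<comment> \<open>The omitted elementary sets each violate one inequality of
    \<open>N x A B\<close>: \<open>{x}\<close> at \<open>b\<close>, \<open>- {x}\<close> at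
    \<open>a\<close>, and \<open>{v}\<close> with \<open>v \<in> A\<close> or \<open>- {v}\<close>
    with \<open>v \<in> B\<close> at \<open>v\<close> itself.\<close>
  moreover have "ind_vec D \<notin> set_cone \<A>" if D: "D \<in> elementary_sets" "D \<notin> \<A>" for D
  proof
    assume "ind_vec D \<in> set_cone \<A>"
    then have mem: "ind_vec D \<in> N x A B" by (simp add: cone)
    have not_g: "D \<noteq> g v" if "v \<noteq> x" for v using D(2) that by (auto simp: \<A>_def)
    from D(1) consider v where "D = {v}" | v where "D = - {v}"
      by (auto simp: elementary_sets_def)
    then show False
    proof cases
      case 1
      show False
      proof (cases "v = x")
        case True
        then show False using mem 1 ab abx by (auto simp: N_def)
      next
        case False
        then have "v \<in> A" using not_g[OF False] 1 by (auto simp: g_def)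
        then show False using mem 1 False by (auto simp: N_def)
      qed
    next
      case 2
      show False
      proof (cases "v = x")
        case True
        then show False using mem 2 ab abx by (auto simp: N_def)
      next
        case False
        then have "v \<notin> A" using not_g[OF False] 2 by (auto simp: g_def)
        then have "v \<in> B" using False cover by blast
        then show False using mem 2 False by (auto simp: N_def)
      qed
    qed
  qed
  moreover have "\<A> \<subseteq> insert UNIV elementary_sets"
    by (auto simp: \<A>_def g_def elementary_sets_def)
  ultimately show ?thesis
    unfolding mesc_def using cone by (intro exI[of _ \<A>]) (auto simp: \<A>_def)
qed

theorem theorem3:
  fixes x :: "'n::finite" and A B :: "'n set"
  assumes "admissible x A B"
  shows
    "convex_cone (N x A B)
     \<and> (\<exists>l u. pri_model l u \<and> coherent l u \<and> normal_cone_of (N x A B) (credal_set l u))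
     \<and> (A \<union> B = - {x} \<longleftrightarrow> mesc (N x A B))
     \<and> (\<forall>A' B'. A' \<subseteq> A \<and> B' \<subseteq> B \<and> A' \<noteq> {} \<and> B' \<noteq> {} \<longrightarrow> N x A' B' face_of N x A B)
     \<and> rel_interior (N x A B) =
         {f. (\<forall>y\<in>A. f $ y < f $ x) \<and> (\<forall>z\<in>B. f $ z > f $ x) \<and>
             (\<forall>w\<in>- (A \<union> B). f $ w = f $ x)}
     \<and> ((\<forall>(f :: real ^ 'n) y. above_set f y \<noteq> {} \<and> below_set f y \<noteq> {} \<longrightarrow>
           f \<in> rel_interior (N y (below_set f y) (above_set f y)))
        \<and> (\<forall>f. f \<in> rel_interior (N x A B) \<longleftrightarrow> A = below_set f x \<and> B = above_set f x))
     \<and> (\<forall>f :: real ^ 'n.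
           finite {N y C D | y C D. admissible y C D \<and> f \<in> rel_interior (N y C D)} \<and>
           card {N y C D | y C D. admissible y C D \<and> f \<in> rel_interior (N y C D)} \<le> CARD('n) - 2)
     \<and> (\<forall>\<A>. maximal_chain \<A> \<longrightarrow>
           rel_interior (set_cone \<A>) \<subseteq> N x A B \<or> rel_interior (set_cone \<A>) \<inter> N x A B = {})"
proof (intro conjI)
  show "convex_cone (N x A B)" by (rule convex_cone_N)
  show "\<exists>l u. pri_model l u \<and> coherent l u \<and> normal_cone_of (N x A B) (credal_set l u)"
    using assms by (rule N_normal_cone)
  show "A \<union> B = - {x} \<longleftrightarrow> mesc (N x A B)"
    using assms cover_imp_mesc mesc_imp_cover by blast
  show "\<forall>A' B'. A' \<subseteq> A \<and> B' \<subseteq> B \<and> A' \<noteq> {} \<and> B' \<noteq> {} \<longrightarrow> N x A' B' face_of N x A B"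
    using assms N_face_of by blast
  show "\<forall>(f :: real ^ 'n) y. above_set f y \<noteq> {} \<and> below_set f y \<noteq> {} \<longrightarrow>
          f \<in> rel_interior (N y (below_set f y) (above_set f y))"
    using rel_interior_N_iff admissible_below_above by blast
  show "\<forall>f. f \<in> rel_interior (N x A B) \<longleftrightarrow> A = below_set f x \<and> B = above_set f x"
    using assms rel_interior_N_iff by blast
  show "\<forall>\<A>. maximal_chain \<A> \<longrightarrow>
          rel_interior (set_cone \<A>) \<subseteq> N x A B \<or> rel_interior (set_cone \<A>) \<inter> N x A B = {}"
    using assms maximal_chain_cone_N by blast
  show "rel_interior (N x A B) =
         {f. (\<forall>y\<in>A. f $ y < f $ x) \<and> (\<forall>z\<in>B. f $ z > f $ x) \<and>
             (\<forall>w\<in>- (A \<union> B). f $ w = f $ x)}"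
    using assms by (rule rel_interior_N)
  show "\<forall>f :: real ^ 'n.
          finite {N y C D | y C D. admissible y C D \<and> f \<in> rel_interior (N y C D)} \<and>
          card {N y C D | y C D. admissible y C D \<and> f \<in> rel_interior (N y C D)} \<le> CARD('n) - 2"
    using card_cones_le by blast
qed

end
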